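(* Let $\Phi$ be a metric space with a bornology $\mathbb{B}$, let $\mathcal{C}\subset\mathbb{R}^m$ be a closed cone with non-empty interior, let $\Sigma\subset\mathcal{C}$ be a time arrow, and let $S(h):\Phi\to\Phi$, $h\in\mathcal{C}$, be a multi-parametric semigroup. Assume that the operators $S(h)$ are continuous for all $h\in\mathcal{C}$, that $S(h)$ possesses a compact $(\mathbb{B},\Sigma)$-attracting set $K$, and that in addition $K$ is bounded, i.e. $K\in\mathbb{B}$. Then the $(\mathbb{B},\Sigma)$-attractor $\mathcal{A}\subset K$ of $S(h)$ (which exists under these assumptions) satisfies $$\mathcal{A}=\mathcal{K}\big|_{h=0}:=\{u(0): u\in\mathcal{K}\},$$ where $\mathcal{K}$ is the set of all complete bounded trajectories of the semigroup $S(h)$.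
   Context: Setting and definitions. - $\mathcal{C}\subset\mathbb{R}^m$ is a closed cone with non-empty interior, closed under addition ($\mathcal{C}+\mathcal{C}\subset\mathcal{C}$) and containing $0$; the case $\mathcal{C}=\mathbb{R}^m$ is allowed. - A multi-parametric semigroup is a family of maps $S(h):\Phi\to\Phi$, $h\in\mathcal{C}$, with $S(0)=\mathrm{Id}$ and $S(h_1+h_2)=S(h_1)\circ S(h_2)$ for all $h_1,h_2\in\mathcal{C}$. - A bornology $\mathbb{B}$ on $\Phi$ means here an arbitrary collection of subsets of $\Phi$; its members are called "bounded" sets. - A time arrow is a non-empty set $\Sigma\subset\mathcal{C}$ such that $\partial\mathcal{C}\subset\partial\Sigma$ (boundaries in $\mathbb{R}^m$) and such that for every $D>0$ there is a point $h_D\in\Sigma$ with $d(h_D,\partial\Sigma)\ge D$. Here $d(h,V)$ is the Euclidean distance from the point $h$ to the set $V$ in $\mathbb{R}^m$, with $d(h,\emptyset)=+\infty$. - A set $K\subset\Phi$ is $(\mathbb{B},\Sigma)$-attracting if for every $B\in\mathbb{B}$ and every neighbourhood $\mathcal{O}(K)$ of $K$ in $\Phi$ there is $D=D(B,\mathcal{O})$ such that $S(h)B\subset\mathcal{O}(K)$ for all $h\in\Sigma$ with $d(h,\partial\Sigma)\ge D$. - A set $\mathcal{A}\subset\Phi$ is a $(\mathbb{B},\Sigma)$-attractor of $S(h)$ if (1) $\mathcal{A}$ is compact in $\Phi$; (2) $\mathcal{A}$ is strictly invariant: $S(h)\mathcal{A}=\mathcal{A}$ for all $h\in\mathcal{C}$;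 (3) $\mathcal{A}$ is $(\mathbb{B},\Sigma)$-attracting. - A function $u:\mathbb{R}^m\to\Phi$ is a complete bounded trajectory of $S(h)$ if (1) $S(h)u(s)=u(h+s)$ for all $h\in\mathcal{C}$ and $s\in\mathbb{R}^m$; (2) there is a set $B_u\in\mathbb{B}$ such that $u(s)\in B_u$ for all $s\in\mathbb{R}^m$. *)

theory Defs
  imports "HOL-Analysis.Analysis"
begin

definition time_cone :: "(real ^ 'm) set \<Rightarrow> bool" where
  "time_cone C \<longleftrightarrow>
     cone C \<and> closed C \<and> interior C \<noteq> {} \<and> 0 \<in> C \<and> (\<forall>x\<in>C. \<forall>y\<in>C. x + y \<in> C)"

text \<open>
  Only the values of \<open>S h\<close> for \<open>h \<in> C\<close> are meaningful.
\<close>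
definition multiparam_semigroup ::
    "(real ^ 'm) set \<Rightarrow> (real ^ 'm \<Rightarrow> 'a \<Rightarrow> 'a) \<Rightarrow> bool" where
  "multiparam_semigroup C S \<longleftrightarrow>
     S 0 = id \<and> (\<forall>h\<^sub>1\<in>C. \<forall>h\<^sub>2\<in>C. S (h\<^sub>1 + h\<^sub>2) = S h\<^sub>1 \<circ> S h\<^sub>2)"

text \<open>
  The library's \<open>infdist\<close> and \<open>setdist\<close> are \<open>0\<close> on the empty set. Here the distance
  to the empty set has to be \<open>\<infinity>\<close>, which is the infimum of the empty set in \<open>ereal\<close>;
  this matters when \<open>\<Sigma>\<close> is the whole space.
\<close>
definition edist_set :: "'a::metric_space \<Rightarrow> 'a set \<Rightarrow> ereal" where
  "edist_set x V = (INF v\<in>V. ereal (dist x v))"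

definition time_arrow :: "(real ^ 'm) set \<Rightarrow> (real ^ 'm) set \<Rightarrow> bool" where
  "time_arrow C \<Sigma> \<longleftrightarrow>
     \<Sigma> \<noteq> {} \<and> \<Sigma> \<subseteq> C \<and> frontier C \<subseteq> frontier \<Sigma> \<and>
     (\<forall>D::real. D > 0 \<longrightarrow> (\<exists>h\<in>\<Sigma>. edist_set h (frontier \<Sigma>) \<ge> ereal D))"

text \<open>
  The bornology \<open>\<B>\<close> is an arbitrary collection of sets. A neighbourhood of a set is a
  set, not necessarily open, whose interior contains it.
\<close>
definition attracting ::
    "(real ^ 'm \<Rightarrow> 'a \<Rightarrow> 'a) \<Rightarrow> 'a::metric_space set set \<Rightarrow> (real ^ 'm) set \<Rightarrow> 'a set \<Rightarrow> bool" where
  "attracting S \<B> \<Sigma> K \<longleftrightarrow>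
     (\<forall>B\<in>\<B>. \<forall>U. K \<subseteq> interior U \<longrightarrow>
        (\<exists>D::real. \<forall>h\<in>\<Sigma>. edist_set h (frontier \<Sigma>) \<ge> ereal D \<longrightarrow> S h ` B \<subseteq> U))"

definition attractor ::
    "(real ^ 'm) set \<Rightarrow> (real ^ 'm \<Rightarrow> 'a \<Rightarrow> 'a) \<Rightarrow> 'a::metric_space set set \<Rightarrow>
     (real ^ 'm) set \<Rightarrow> 'a set \<Rightarrow> bool" where
  "attractor C S \<B> \<Sigma> A \<longleftrightarrow>
     compact A \<and> (\<forall>h\<in>C. S h ` A = A) \<and> attracting S \<B> \<Sigma> A"

definition complete_bounded_trajectories ::
    "(real ^ 'm) set \<Rightarrow> (real ^ 'm \<Rightarrow> 'a \<Rightarrow> 'a) \<Rightarrow> 'a set set \<Rightarrow> (real ^ 'm \<Rightarrow> 'a) set" where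
  "complete_bounded_trajectories C S \<B> =
     {u. (\<forall>h\<in>C. \<forall>s. S h (u s) = u (h + s)) \<and> (\<exists>B\<in>\<B>. \<forall>s. u s \<in> B)}"

end

theory Submission
  imports Defs
begin

text \<open>
  The attractor is the \<open>\<omega>\<close>-limit set of \<open>K\<close>, taken along times that lie ever deeper inside
  \<open>\<Sigma>\<close>. What makes the one-parameter theory carry over is lemma \<open>going_deep_shift\<close>: if a
  ball around \<open>h \<in> \<Sigma>\<close> misses the frontier of \<open>\<Sigma>\<close>, then it lies in \<open>\<Sigma>\<close>, so a translation by a
  fixed vector, in any direction, turns a sequence of times with this property into another one.
  Forward shifts and continuity give \<open>S c ` \<omega>(B) \<subseteq> \<omega>(B)\<close>; backward shifts and the
  compactness of \<open>K\<close> give the opposite inclusion. Compactness also shows that \<open>\<omega>(B)\<close> attracts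
  \<open>B\<close>, so \<open>\<omega>(K)\<close> attracts every bounded set because \<open>\<omega>(B) \<subseteq> \<omega>(K)\<close> for every bounded
  \<open>B\<close>. Indeed, the set \<open>\<omega>(B)\<close> lies in \<open>K\<close> and is invariant, so each of its points equals \<open>S h z\<close> with
  \<open>z \<in> K\<close> for every \<open>h \<in> C\<close>, in particular for arbitrarily deep \<open>h\<close>.

  Now let \<open>A \<subseteq> K\<close> be any attractor. If \<open>u\<close> is a complete bounded trajectory, then
  \<open>u 0 = S h (u (- h))\<close> for all \<open>h \<in> C\<close>, and for deep \<open>h\<close> this is as close to \<open>A\<close> as desired; as
  \<open>A\<close> is closed, \<open>u 0 \<in> A\<close>. Conversely, for \<open>a \<in> A\<close> fix an interior vector \<open>e\<close> of the cone
  and use \<open>S e ` A = A\<close> to pick a backward orbit \<open>a = a\<^sub>0, a\<^sub>1, \<dots>\<close> in \<open>A\<close> with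
  \<open>S e a\<^sub>n\<^sub>+\<^sub>1 = a\<^sub>n\<close>. Since \<open>s + n e \<in> C\<close> for large \<open>n\<close>, the formula \<open>u s = S (s + n e) a\<^sub>n\<close>
  defines \<open>u\<close> on the whole space; it stays in \<open>A \<subseteq> K\<close>, and \<open>K\<close> is bounded.
\<close>

section \<open>Going deep into a time arrow\<close>

definition deep_region :: "'a::metric_space set \<Rightarrow> real \<Rightarrow> 'a set" where
  "deep_region \<Sigma> D = {h \<in> \<Sigma>. ereal D \<le> edist_set h (frontier \<Sigma>)}"

definition going_deep :: "'a::metric_space set \<Rightarrow> (nat \<Rightarrow> 'a) \<Rightarrow> bool" where
  "going_deep \<Sigma> \<sigma> \<longleftrightarrow> (\<forall>D. \<forall>\<^sub>F n in sequentially. \<sigma> n \<in> deep_region \<Sigma> D)"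

lemma deep_region_iff:
  "h \<in> deep_region \<Sigma> D \<longleftrightarrow> h \<in> \<Sigma> \<and> (\<forall>v\<in>frontier \<Sigma>. D \<le> dist h v)"
  by (simp add: deep_region_def edist_set_def le_INF_iff)

lemma deep_region_antimono: "D \<le> D' \<Longrightarrow> deep_region \<Sigma> D' \<subseteq> deep_region \<Sigma> D"
  by (force simp: deep_region_iff)

lemma going_deepI:
  assumes "\<And>n. \<sigma> n \<in> deep_region \<Sigma> (real n)"
  shows "going_deep \<Sigma> \<sigma>"
  unfolding going_deep_def
proof
  fix D :: real
  obtain N :: nat where "D \<le> real N"
    using real_arch_simple by blast
  then have "\<sigma> n \<in> deep_region \<Sigma> D" if "n \<ge> N" for n
    using assms[of n] deep_region_antimono[of D "real n" \<Sigma>] that by force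
  then show "\<forall>\<^sub>F n in sequentially. \<sigma> n \<in> deep_region \<Sigma> D"
    using eventually_sequentially by blast
qed

lemma going_deep_subseq:
  assumes "going_deep \<Sigma> \<sigma>" and "strict_mono r"
  shows "going_deep \<Sigma> (\<sigma> \<circ> r)"
  using assms eventually_subseq unfolding going_deep_def comp_def by blast

text \<open>
  The ball of radius \<open>norm c\<close> around \<open>h \<in> \<Sigma>\<close> is connected, so it could leave
  \<open>\<Sigma>\<close> only through the frontier.
\<close>
lemma deep_region_shift:
  fixes h c :: "'a::real_normed_vector"
  assumes h: "h \<in> deep_region \<Sigma> (D + norm c)" and "D > 0"
  shows "h + c \<in> deep_region \<Sigma> D"
proof -
  have far: "D + norm c \<le> dist h v" if "v \<in> frontier \<Sigma>" for v
    using h that by (simp add: deep_region_iff)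
  have "cball h (norm c) \<inter> frontier \<Sigma> = {}"
    using far \<open>D > 0\<close> by fastforce
  moreover have "h \<in> cball h (norm c) \<inter> \<Sigma>"
    using h by (simp add: deep_region_iff)
  moreover have "connected (cball h (norm c))"
    by (simp add: convex_connected)
  ultimately have "cball h (norm c) \<subseteq> \<Sigma>"
    using connected_Int_frontier[of "cball h (norm c)" \<Sigma>] by blast
  moreover have "h + c \<in> cball h (norm c)"
    by (simp add: dist_norm)
  moreover have "D \<le> dist (h + c) v" if "v \<in> frontier \<Sigma>" for v
  proof -
    have "dist h (h + c) = norm c"
      by (simp add: dist_norm)
    then show ?thesis
      using far[OF that] dist_triangle[of h v "h + c"] by linarith
  qed
  ultimately show ?thesis
    by (auto simp: deep_region_iff)
qed

lemma going_deep_shift: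
  fixes c :: "'a::real_normed_vector"
  assumes "going_deep \<Sigma> \<sigma>"
  shows "going_deep \<Sigma> (\<lambda>n. \<sigma> n + c)"
  unfolding going_deep_def
proof
  fix D :: real
  have "\<forall>\<^sub>F n in sequentially. \<sigma> n \<in> deep_region \<Sigma> (max D 1 + norm c)"
    using assms by (simp add: going_deep_def)
  then show "\<forall>\<^sub>F n in sequentially. \<sigma> n + c \<in> deep_region \<Sigma> D"
  proof eventually_elim
    case (elim n)
    then have "\<sigma> n + c \<in> deep_region \<Sigma> (max D 1)"
      by (rule deep_region_shift) simp
    then show ?case
      using deep_region_antimono[of D "max D 1" \<Sigma>] by auto
  qed
qed

lemma time_arrow_deep_sequence:
  assumes "time_arrow C \<Sigma>"
  obtains \<sigma> where "going_deep \<Sigma> \<sigma>" and "\<And>n. \<sigma> n \<in> \<Sigma>"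
proof -
  have "\<exists>h. h \<in> deep_region \<Sigma> (real n)" for n
  proof -
    have "real n + 1 > 0"
      by simp
    then obtain h where "h \<in> deep_region \<Sigma> (real n + 1)"
      using assms unfolding time_arrow_def deep_region_def by blast
    then show ?thesis
      using deep_region_antimono[of "real n" "real n + 1" \<Sigma>] by auto
  qed
  then obtain \<sigma> where \<sigma>: "\<And>n. \<sigma> n \<in> deep_region \<Sigma> (real n)"
    by metis
  show ?thesis
  proof
    show "going_deep \<Sigma> \<sigma>"
      using \<sigma> by (rule going_deepI)
    show "\<sigma> n \<in> \<Sigma>" for n
      using \<sigma>[of n] by (simp add: deep_region_iff)
  qed
qed

lemma attracting_eventually:
  assumes "attracting S \<B> \<Sigma> K" and "B \<in> \<B>" and "K \<subseteq> interior U" and "going_deep \<Sigma> \<sigma>"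
  shows "\<forall>\<^sub>F n in sequentially. S (\<sigma> n) ` B \<subseteq> U"
proof -
  obtain D where D: "\<And>h. h \<in> deep_region \<Sigma> D \<Longrightarrow> S h ` B \<subseteq> U"
    using assms(1-3) unfolding attracting_def deep_region_def by blast
  have "\<forall>\<^sub>F n in sequentially. \<sigma> n \<in> deep_region \<Sigma> D"
    using assms(4) by (simp add: going_deep_def)
  then show ?thesis
    by eventually_elim (rule D)
qed

section \<open>Limit sets of a semigroup with a compact attracting set\<close>

definition omega_limit ::
    "(real ^ 'm \<Rightarrow> 'a \<Rightarrow> 'a) \<Rightarrow> (real ^ 'm) set \<Rightarrow> 'a::metric_space set \<Rightarrow> 'a set" where
  "omega_limit S \<Sigma> B = (\<Inter>D. closure (\<Union>h\<in>deep_region \<Sigma> D. S h ` B))"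

lemma closed_omega_limit: "closed (omega_limit S \<Sigma> B)"
  by (simp add: omega_limit_def closed_INT)

lemma omega_limitI:
  assumes \<sigma>: "going_deep \<Sigma> \<sigma>" and b: "\<And>n. b n \<in> B" and lim: "(\<lambda>n. S (\<sigma> n) (b n)) \<longlonglongrightarrow> x"
  shows "x \<in> omega_limit S \<Sigma> B"
  unfolding omega_limit_def
proof
  fix D
  have "\<forall>\<^sub>F n in sequentially. \<sigma> n \<in> deep_region \<Sigma> D"
    using \<sigma> by (simp add: going_deep_def)
  then have "\<forall>\<^sub>F n in sequentially. S (\<sigma> n) (b n) \<in> closure (\<Union>h\<in>deep_region \<Sigma> D. S h ` B)"
    by eventually_elim (rule subsetD[OF closure_subset], use b in blast)
  then show "x \<in> closure (\<Union>h\<in>deep_region \<Sigma> D. S h ` B)"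
    using lim by (intro Lim_in_closed_set[OF closed_closure _ trivial_limit_sequentially])
qed

lemma omega_limitE:
  assumes "x \<in> omega_limit S \<Sigma> B"
  obtains \<sigma> b where "going_deep \<Sigma> \<sigma>" and "\<And>n. b n \<in> B" and "(\<lambda>n. S (\<sigma> n) (b n)) \<longlonglongrightarrow> x"
proof -
  have "\<exists>h b. h \<in> deep_region \<Sigma> (real n) \<and> b \<in> B \<and> dist (S h b) x < inverse (real (Suc n))" for n
  proof -
    have "x \<in> closure (\<Union>h\<in>deep_region \<Sigma> (real n). S h ` B)"
      using assms by (simp add: omega_limit_def)
    moreover have "inverse (real (Suc n)) > 0"
      by simp
    ultimately obtain y where "y \<in> (\<Union>h\<in>deep_region \<Sigma> (real n). S h ` B)"
      and "dist y x < inverse (real (Suc n))"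
      by (meson closure_approachable)
    then show ?thesis
      by blast
  qed
  then obtain \<sigma> b where \<sigma>: "\<And>n. \<sigma> n \<in> deep_region \<Sigma> (real n)" and b: "\<And>n. b n \<in> B"
    and close: "\<And>n. dist (S (\<sigma> n) (b n)) x < inverse (real (Suc n))"
    by metis
  have "(\<lambda>n. dist (S (\<sigma> n) (b n)) x) \<longlonglongrightarrow> 0"
    by (rule tendsto_sandwich[OF _ _ tendsto_const LIMSEQ_inverse_real_of_nat])
      (use close in \<open>auto intro!: always_eventually less_imp_le\<close>)
  then have "(\<lambda>n. S (\<sigma> n) (b n)) \<longlonglongrightarrow> x"
    by (simp add: tendsto_dist_iff[symmetric])
  with going_deepI[OF \<sigma>] b show ?thesis
    by (rule that)
qed

locale compactly_attracted_semigroup =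
  fixes C \<Sigma> :: "(real ^ 'm) set"
    and S :: "real ^ 'm \<Rightarrow> 'a::metric_space \<Rightarrow> 'a"
    and \<B> :: "'a set set"
    and K :: "'a set"
  assumes arrow: "time_arrow C \<Sigma>"
    and semigroup: "multiparam_semigroup C S"
    and continuous: "\<And>h. h \<in> C \<Longrightarrow> continuous_on UNIV (S h)"
    and compact_K: "compact K"
    and attracting_K: "attracting S \<B> \<Sigma> K"
begin

lemma arrow_subset: "\<Sigma> \<subseteq> C"
  using arrow by (simp add: time_arrow_def)

lemma semigroup_add: "h \<in> C \<Longrightarrow> k \<in> C \<Longrightarrow> S (h + k) x = S h (S k x)"
  using semigroup by (simp add: multiparam_semigroup_def)

lemma going_deep_in_cone:
  assumes "going_deep \<Sigma> \<sigma>"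
  shows "\<forall>\<^sub>F n in sequentially. \<sigma> n \<in> C"
proof -
  from assms have "\<forall>\<^sub>F n in sequentially. \<sigma> n \<in> deep_region \<Sigma> 0"
    by (simp add: going_deep_def)
  then show ?thesis
    by eventually_elim (use arrow_subset in \<open>auto simp: deep_region_iff\<close>)
qed

text \<open>
  The points come arbitrarily close to \<open>K\<close>, so they share their accumulation points
  with a sequence of nearby points of the compact set \<open>K\<close>.
\<close>
lemma asymptotically_compact:
  assumes "B \<in> \<B>" and \<sigma>: "going_deep \<Sigma> \<sigma>" and b: "\<And>n. b n \<in> B"
  obtains r x where "strict_mono (r :: nat \<Rightarrow> nat)" and "x \<in> K"
    and "(\<lambda>n. S (\<sigma> (r n)) (b (r n))) \<longlonglongrightarrow> x"
proof -
  define y where "y n = S (\<sigma> n) (b n)" for n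
  have near: "\<forall>\<^sub>F n in sequentially. \<exists>k\<in>K. dist k (y n) < \<epsilon>" if "\<epsilon> > 0" for \<epsilon>
  proof -
    have "open (\<Union>k\<in>K. ball k \<epsilon>)"
      by blast
    then have "K \<subseteq> interior (\<Union>k\<in>K. ball k \<epsilon>)"
      using that by (force simp: interior_open)
    from attracting_eventually[OF attracting_K \<open>B \<in> \<B>\<close> this \<sigma>] show ?thesis
      by eventually_elim (use b in \<open>force simp: y_def\<close>)
  qed
  have step: "\<exists>n. n > N \<and> (\<exists>k\<in>K. dist k (y n) < inverse (real (Suc j)))" for j N
  proof -
    have "inverse (real (Suc j)) > 0"
      by simp
    from eventually_conj[OF eventually_gt_at_top[of N] near[OF this]] show ?thesis
      using eventually_happens' trivial_limit_sequentially by fast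
  qed
  have "\<exists>f. \<forall>j. (\<exists>k\<in>K. dist k (y (f j)) < inverse (real (Suc j))) \<and> f j < f (Suc j)"
    by (rule dependent_nat_choice) (use step in blast)+
  then obtain f where f: "\<And>j. \<exists>k\<in>K. dist k (y (f j)) < inverse (real (Suc j))"
    and "\<And>j. f j < f (Suc j)"
    by blast
  then have "strict_mono f"
    by (simp add: strict_mono_Suc_iff)
  obtain k where k: "\<And>j. k j \<in> K" and close: "\<And>j. dist (k j) (y (f j)) < inverse (real (Suc j))"
    using f by metis
  have "(\<lambda>j. dist (k j) (y (f j))) \<longlonglongrightarrow> 0"
    by (rule tendsto_sandwich[OF _ _ tendsto_const LIMSEQ_inverse_real_of_nat])
      (use close in \<open>auto intro!: always_eventually less_imp_le\<close>)
  moreover obtain x q where "x \<in> K" "strict_mono q" and lim: "(k \<circ> q) \<longlonglongrightarrow> x"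
    using compact_K k unfolding compact_def by metis
  ultimately have "(\<lambda>j. dist (k (q j)) (y (f (q j)))) \<longlonglongrightarrow> 0"
    using LIMSEQ_subseq_LIMSEQ[of "\<lambda>j. dist (k j) (y (f j))" 0 q] by (simp add: comp_def)
  moreover have "(\<lambda>j. dist (k (q j)) x) \<longlonglongrightarrow> 0"
    using tendsto_dist_iff[THEN iffD1, OF lim] by (simp add: comp_def)
  ultimately have "(\<lambda>j. dist (k (q j)) (y (f (q j))) + dist (k (q j)) x) \<longlonglongrightarrow> 0"
    by (rule tendsto_add_zero)
  then have "(\<lambda>j. dist (y (f (q j))) x) \<longlonglongrightarrow> 0"
    by (rule tendsto_sandwich[OF _ _ tendsto_const, rotated 2])
      (simp_all add: dist_triangle3)
  then have "(\<lambda>j. y (f (q j))) \<longlonglongrightarrow> x"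
    by (simp add: tendsto_dist_iff[symmetric])
  moreover have "strict_mono (f \<circ> q)"
    using \<open>strict_mono f\<close> \<open>strict_mono q\<close> by (rule strict_mono_o)
  ultimately show ?thesis
    using that[of "f \<circ> q" x] \<open>x \<in> K\<close> by (simp add: y_def)
qed

lemma omega_limit_subset:
  assumes "B \<in> \<B>"
  shows "omega_limit S \<Sigma> B \<subseteq> K"
proof
  fix x
  assume "x \<in> omega_limit S \<Sigma> B"
  then obtain \<sigma> b where \<sigma>: "going_deep \<Sigma> \<sigma>" and b: "\<And>n. b n \<in> B"
    and lim: "(\<lambda>n. S (\<sigma> n) (b n)) \<longlonglongrightarrow> x"
    by (rule omega_limitE) (rule that)
  obtain r y where r: "strict_mono r" and "y \<in> K" and y: "(\<lambda>n. S (\<sigma> (r n)) (b (r n))) \<longlonglongrightarrow> y"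
    by (rule asymptotically_compact[of B \<sigma> b, OF assms \<sigma> b]) (rule that)
  have "(\<lambda>n. S (\<sigma> (r n)) (b (r n))) \<longlonglongrightarrow> x"
    using LIMSEQ_subseq_LIMSEQ[OF lim r] by (simp add: comp_def)
  from LIMSEQ_unique[OF this y] show "x \<in> K"
    using \<open>y \<in> K\<close> by simp
qed

lemma compact_omega_limit:
  assumes "B \<in> \<B>"
  shows "compact (omega_limit S \<Sigma> B)"
  using compact_Int_closed[OF compact_K closed_omega_limit[of S \<Sigma> B]]
  by (simp add: inf_absorb2 omega_limit_subset[OF assms])

lemma continuous_limit:
  assumes "c \<in> C" and "y \<longlonglongrightarrow> x"
  shows "(\<lambda>n. S c (y n)) \<longlonglongrightarrow> S c x"
  by (rule continuous_on_tendsto_compose[OF continuous[OF assms(1)] assms(2)]) simp_all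

lemma omega_limit_invariant:
  assumes "B \<in> \<B>" and c: "c \<in> C"
  shows "S c ` omega_limit S \<Sigma> B = omega_limit S \<Sigma> B"
proof
  show "S c ` omega_limit S \<Sigma> B \<subseteq> omega_limit S \<Sigma> B"
  proof
    fix z
    assume "z \<in> S c ` omega_limit S \<Sigma> B"
    then obtain x where z: "z = S c x" and "x \<in> omega_limit S \<Sigma> B"
      by blast
    from this(2) obtain \<sigma> b where \<sigma>: "going_deep \<Sigma> \<sigma>" and b: "\<And>n. b n \<in> B"
      and lim: "(\<lambda>n. S (\<sigma> n) (b n)) \<longlonglongrightarrow> x"
      by (rule omega_limitE) (rule that)
    have "\<forall>\<^sub>F n in sequentially. S c (S (\<sigma> n) (b n)) = S (\<sigma> n + c) (b n)"
      using going_deep_in_cone[OF \<sigma>]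
      by eventually_elim (metis semigroup_add c add.commute)
    then have "(\<lambda>n. S (\<sigma> n + c) (b n)) \<longlonglongrightarrow> S c x"
      by (rule Lim_transform_eventually[OF continuous_limit[OF c lim]])
    then show "z \<in> omega_limit S \<Sigma> B"
      unfolding z by (rule omega_limitI[where b = b, OF going_deep_shift[OF \<sigma>] b])
  qed
  show "omega_limit S \<Sigma> B \<subseteq> S c ` omega_limit S \<Sigma> B"
  proof
    fix x
    assume "x \<in> omega_limit S \<Sigma> B"
    then obtain \<sigma> b where \<sigma>: "going_deep \<Sigma> \<sigma>" and b: "\<And>n. b n \<in> B"
      and lim: "(\<lambda>n. S (\<sigma> n) (b n)) \<longlonglongrightarrow> x"
      by (rule omega_limitE) (rule that)
    \<comment> \<open>A preimage of \<open>x\<close> is an accumulation point of the same orbits stopped \<open>c\<close> earlier.\<close>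
    define \<tau> where "\<tau> n = \<sigma> n - c" for n
    have \<tau>: "going_deep \<Sigma> \<tau>"
      using going_deep_shift[OF \<sigma>, of "- c"] by (simp add: \<tau>_def[abs_def])
    obtain r y where r: "strict_mono r" and y: "(\<lambda>n. S (\<tau> (r n)) (b (r n))) \<longlonglongrightarrow> y"
      by (rule asymptotically_compact[of B \<tau> b, OF assms(1) \<tau> b]) (rule that)
    have \<tau>r: "going_deep \<Sigma> (\<lambda>n. \<tau> (r n))"
      using going_deep_subseq[OF \<tau> r] by (simp add: comp_def)
    then have "y \<in> omega_limit S \<Sigma> B"
      using b y by (rule omega_limitI[where b = "\<lambda>n. b (r n)"])
    moreover have "S c y = x"
    proof -
      have "\<forall>\<^sub>F n in sequentially. S c (S (\<tau> (r n)) (b (r n))) = S (\<sigma> (r n)) (b (r n))"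
        using going_deep_in_cone[OF \<tau>r]
        by eventually_elim (simp add: semigroup_add[symmetric] c \<tau>_def)
      then have "(\<lambda>n. S (\<sigma> (r n)) (b (r n))) \<longlonglongrightarrow> S c y"
        by (rule Lim_transform_eventually[OF continuous_limit[OF c y]])
      moreover have "(\<lambda>n. S (\<sigma> (r n)) (b (r n))) \<longlonglongrightarrow> x"
        using LIMSEQ_subseq_LIMSEQ[OF lim r] by (simp add: comp_def)
      ultimately show ?thesis
        by (rule LIMSEQ_unique)
    qed
    ultimately show "x \<in> S c ` omega_limit S \<Sigma> B"
      by blast
  qed
qed

text \<open>
  By invariance, a point of \<open>\<omega>(B) \<subseteq> K\<close> is reached from \<open>K\<close> at every time, so it is the limit of a
  constant sequence of points \<open>S h z\<close> with \<open>z \<in> K\<close> and \<open>h\<close> going deep.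
\<close>
lemma omega_limit_subset_omega_limit:
  assumes "B \<in> \<B>"
  shows "omega_limit S \<Sigma> B \<subseteq> omega_limit S \<Sigma> K"
proof
  fix x
  assume x: "x \<in> omega_limit S \<Sigma> B"
  obtain \<sigma> where \<sigma>: "going_deep \<Sigma> \<sigma>" and "\<And>n. \<sigma> n \<in> \<Sigma>"
    by (rule time_arrow_deep_sequence[OF arrow]) (rule that)
  then have "\<exists>z. z \<in> K \<and> S (\<sigma> n) z = x" for n
    using omega_limit_invariant[OF assms, of "\<sigma> n"] x omega_limit_subset[OF assms] arrow_subset
    by (metis imageE subsetD)
  then obtain z where "\<And>n. z n \<in> K" and "\<And>n. S (\<sigma> n) (z n) = x"
    by metis
  then show "x \<in> omega_limit S \<Sigma> K"
    using omega_limitI[OF \<sigma>, of z K S x] by simp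
qed

text \<open>
  Points of \<open>S h ` B\<close> that stay outside a neighbourhood of \<open>\<omega>(K)\<close> at ever deeper times would
  accumulate at a point of \<open>\<omega>(B)\<close> outside the interior of that neighbourhood.
\<close>
lemma omega_limit_attracting: "attracting S \<B> \<Sigma> (omega_limit S \<Sigma> K)"
  unfolding attracting_def
proof (intro ballI allI impI, rule ccontr)
  fix B U
  assume B: "B \<in> \<B>" and U: "omega_limit S \<Sigma> K \<subseteq> interior U"
    and "\<not> (\<exists>D. \<forall>h\<in>\<Sigma>. ereal D \<le> edist_set h (frontier \<Sigma>) \<longrightarrow> S h ` B \<subseteq> U)"
  then have "\<exists>h b. h \<in> deep_region \<Sigma> (real n) \<and> b \<in> B \<and> S h b \<notin> U" for n
    unfolding deep_region_def by blast
  then obtain \<sigma> b where \<sigma>: "\<And>n. \<sigma> n \<in> deep_region \<Sigma> (real n)" and b: "\<And>n. b n \<in> B"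
    and outside: "\<And>n. S (\<sigma> n) (b n) \<notin> U"
    by metis
  have deep: "going_deep \<Sigma> \<sigma>"
    using \<sigma> by (rule going_deepI)
  obtain r x where r: "strict_mono r" and lim: "(\<lambda>n. S (\<sigma> (r n)) (b (r n))) \<longlonglongrightarrow> x"
    by (rule asymptotically_compact[of B \<sigma> b, OF B deep b]) (rule that)
  have "x \<in> omega_limit S \<Sigma> B"
    using omega_limitI[of \<Sigma> "\<sigma> \<circ> r" "b \<circ> r"] going_deep_subseq[OF deep r] b lim by simp
  then have "x \<in> interior U"
    using omega_limit_subset_omega_limit[OF B] U by blast
  then have "\<forall>\<^sub>F n in sequentially. S (\<sigma> (r n)) (b (r n)) \<in> interior U"
    using lim topological_tendstoD open_interior by blast
  then show False
    using outside interior_subset eventually_happens' trivial_limit_sequentially by blast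
qed

lemma omega_limit_attractor:
  assumes "K \<in> \<B>"
  shows "attractor C S \<B> \<Sigma> (omega_limit S \<Sigma> K)"
  using assms compact_omega_limit omega_limit_invariant omega_limit_attracting
  by (simp add: attractor_def)

end

section \<open>Complete trajectories\<close>

text \<open>
  The value of a trajectory at \<open>0\<close> equals \<open>S h (u (- h))\<close> for arbitrarily deep \<open>h\<close>, so it lies in
  every neighbourhood of the attracting set.
\<close>
lemma trajectory_in_closed_attracting:
  assumes arrow: "time_arrow C \<Sigma>" and "closed A" and attr: "attracting S \<B> \<Sigma> A"
    and u: "u \<in> complete_bounded_trajectories C S \<B>"
  shows "u 0 \<in> A"
proof (rule ccontr)
  assume "u 0 \<notin> A"
  obtain B where "B \<in> \<B>" and B: "\<And>s. u s \<in> B"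
    and shift: "\<And>h s. h \<in> C \<Longrightarrow> S h (u s) = u (h + s)"
    using u unfolding complete_bounded_trajectories_def by blast
  have "A \<subseteq> interior (- {u 0})"
    using \<open>u 0 \<notin> A\<close> by (simp add: interior_open open_Compl)
  obtain \<sigma> where \<sigma>: "going_deep \<Sigma> \<sigma>" "\<And>n. \<sigma> n \<in> \<Sigma>"
    by (rule time_arrow_deep_sequence[OF arrow]) (rule that)
  have "\<forall>\<^sub>F n in sequentially. S (\<sigma> n) ` B \<subseteq> - {u 0}"
    using attr \<open>B \<in> \<B>\<close> \<open>A \<subseteq> interior (- {u 0})\<close> \<sigma>(1) by (rule attracting_eventually)
  then obtain n where "S (\<sigma> n) ` B \<subseteq> - {u 0}"
    using eventually_happens' trivial_limit_sequentially by blast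
  moreover have "S (\<sigma> n) (u (- \<sigma> n)) = u 0"
  proof -
    have "\<sigma> n \<in> C"
      using \<sigma>(2) arrow unfolding time_arrow_def by blast
    then show ?thesis
      using shift[of "\<sigma> n" "- \<sigma> n"] by simp
  qed
  ultimately show False
    using B by blast
qed

text \<open>
  After rescaling, \<open>s + n e\<close> becomes \<open>e + s / n\<close>, which tends to the interior point \<open>e\<close>.
\<close>
lemma cone_absorbs_translates:
  fixes C :: "'a::real_normed_vector set"
  assumes "cone C" and "e \<in> interior C"
  shows "\<forall>\<^sub>F n in sequentially. s + real n *\<^sub>R e \<in> C"
proof -
  have "(\<lambda>n. e + inverse (real n) *\<^sub>R s) \<longlonglongrightarrow> e + 0 *\<^sub>R s"
    by (intro tendsto_intros LIMSEQ_inverse_real_of_nat lim_inverse_n)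
  then have "\<forall>\<^sub>F n in sequentially. e + inverse (real n) *\<^sub>R s \<in> interior C"
    using assms(2) topological_tendstoD[OF _ open_interior] by fastforce
  with eventually_gt_at_top[of 0] show ?thesis
  proof eventually_elim
    case (elim n)
    then have "real n *\<^sub>R (e + inverse (real n) *\<^sub>R s) \<in> C"
      using assms(1) interior_subset by (meson cone_def of_nat_0_le_iff subsetD)
    then show ?case
      using elim by (simp add: algebra_simps)
  qed
qed

text \<open>
  Surjectivity of the single map \<open>S e\<close> on \<open>A\<close>, for one interior direction \<open>e\<close> of the cone, suffices
  to go back in time in all directions: the translates of the cone by \<open>- n e\<close> are nested and cover
  the space, and on each of them the forward semigroup determines the trajectory from its value
  \<open>f n\<close> at the apex \<open>- n e\<close>.
\<close>
lemma trajectory_through_invariant_point: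
  fixes C :: "(real ^ 'm) set"
  assumes cone: "time_cone C" and semigroup: "multiparam_semigroup C S"
    and inv: "\<forall>h\<in>C. S h ` A = A" and "a \<in> A"
  obtains u where "\<And>h s. h \<in> C \<Longrightarrow> S h (u s) = u (h + s)" and "\<And>s. u s \<in> A" and "u 0 = a"
proof -
  have add: "S (h + k) x = S h (S k x)" if "h \<in> C" "k \<in> C" for h k x
    using semigroup that by (simp add: multiparam_semigroup_def)
  have C_add: "h + k \<in> C" if "h \<in> C" "k \<in> C" for h k
    using cone that by (simp add: time_cone_def)
  obtain e where e: "e \<in> interior C"
    using cone by (auto simp: time_cone_def)
  then have "e \<in> C"
    using interior_subset by blast
  have "\<exists>f. \<forall>n. (f n \<in> A \<and> (n = 0 \<longrightarrow> f n = a)) \<and> S e (f (Suc n)) = f n"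
  proof (rule dependent_nat_choice)
    show "\<exists>x. x \<in> A \<and> ((0::nat) = 0 \<longrightarrow> x = a)"
      using \<open>a \<in> A\<close> by blast
    show "\<exists>y. (y \<in> A \<and> (Suc n = 0 \<longrightarrow> y = a)) \<and> S e y = x" if "x \<in> A \<and> (n = 0 \<longrightarrow> x = a)" for x n
      using bspec[OF inv \<open>e \<in> C\<close>] that by (metis imageE nat.distinct(2))
  qed
  then obtain f where fA: "\<And>n. f n \<in> A" and f0: "f 0 = a" and fS: "\<And>n. S e (f (Suc n)) = f n"
    by blast
  \<comment> \<open>The least admissible \<open>n\<close> is only a choice; by \<open>u_eq\<close> below, any other gives the same value.\<close>
  define N where "N s = (LEAST n. s + real n *\<^sub>R e \<in> C)" for s
  define u where "u s = S (s + real (N s) *\<^sub>R e) (f (N s))" for s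
  have N: "s + real (N s) *\<^sub>R e \<in> C" for s
  proof -
    have "\<exists>n. s + real n *\<^sub>R e \<in> C"
      using cone_absorbs_translates[OF _ e, of s] cone
      by (meson eventually_happens' time_cone_def trivial_limit_sequentially)
    then show ?thesis
      unfolding N_def by (rule LeastI_ex)
  qed
  have later: "s + real (n + j) *\<^sub>R e \<in> C \<and>
      S (s + real (n + j) *\<^sub>R e) (f (n + j)) = S (s + real n *\<^sub>R e) (f n)"
    if "s + real n *\<^sub>R e \<in> C" for s n j
  proof (induction j)
    case 0
    show ?case
      using that by simp
  next
    case (Suc j)
    have eq: "s + real (n + Suc j) *\<^sub>R e = (s + real (n + j) *\<^sub>R e) + e"
      by (simp add: algebra_simps)
    show ?case
      unfolding eq using Suc \<open>e \<in> C\<close> by (simp add: C_add add fS)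
  qed
  have u_eq: "u s = S (s + real n *\<^sub>R e) (f n)" if "s + real n *\<^sub>R e \<in> C" for s n
  proof -
    have "N s \<le> n"
      unfolding N_def using that by (rule Least_le)
    then show ?thesis
      using later[OF N, of s "n - N s"] by (simp add: u_def)
  qed
  show ?thesis
  proof
    show "S h (u s) = u (h + s)" if "h \<in> C" for h s
    proof -
      have "h + s + real (N s) *\<^sub>R e \<in> C"
        using C_add[OF that N[of s]] by (simp add: add.assoc)
      then have "u (h + s) = S (h + (s + real (N s) *\<^sub>R e)) (f (N s))"
        using u_eq by (simp add: add.assoc)
      then show ?thesis
        by (simp add: add[OF that N] u_def)
    qed
    show "u s \<in> A" for s
      unfolding u_def using bspec[OF inv N[of s]] fA by blast
    show "u 0 = a"
      using u_eq[of 0 0] cone semigroup f0 by (simp add: time_cone_def multiparam_semigroup_def)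
  qed
qed

theorem corollary2p6:
  fixes C \<Sigma> :: "(real ^ 'm) set"
    and S :: "real ^ 'm \<Rightarrow> 'a::metric_space \<Rightarrow> 'a"
    and \<B> :: "'a set set"
    and K :: "'a set"
  assumes "time_cone C"
    and "time_arrow C \<Sigma>"
    and "multiparam_semigroup C S"
    and "\<And>h. h \<in> C \<Longrightarrow> continuous_on UNIV (S h)"
    and "compact K"
    and "attracting S \<B> \<Sigma> K"
    and "K \<in> \<B>"
  shows "(\<exists>A. A \<subseteq> K \<and> attractor C S \<B> \<Sigma> A) \<and>
         (\<forall>A. A \<subseteq> K \<and> attractor C S \<B> \<Sigma> A \<longrightarrow>
            A = {u 0 | u. u \<in> complete_bounded_trajectories C S \<B>})"
proof (intro conjI allI impI)
  interpret compactly_attracted_semigroup C \<Sigma> S \<B> K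
    using assms by unfold_locales
  show "\<exists>A. A \<subseteq> K \<and> attractor C S \<B> \<Sigma> A"
    using omega_limit_subset omega_limit_attractor assms(7) by blast
next
  fix A
  assume "A \<subseteq> K \<and> attractor C S \<B> \<Sigma> A"
  then have "A \<subseteq> K" and "compact A" and inv: "\<forall>h\<in>C. S h ` A = A"
    and attr: "attracting S \<B> \<Sigma> A"
    by (auto simp: attractor_def)
  show "A = {u 0 | u. u \<in> complete_bounded_trajectories C S \<B>}"
  proof
    show "A \<subseteq> {u 0 | u. u \<in> complete_bounded_trajectories C S \<B>}"
    proof
      fix a
      assume "a \<in> A"
      obtain u where "\<And>h s. h \<in> C \<Longrightarrow> S h (u s) = u (h + s)" and "\<And>s. u s \<in> A" and "u 0 = a"
        by (rule trajectory_through_invariant_point[OF assms(1,3) inv \<open>a \<in> A\<close>]) (rule that)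
      then have "u \<in> complete_bounded_trajectories C S \<B>"
        using \<open>A \<subseteq> K\<close> assms(7) unfolding complete_bounded_trajectories_def by blast
      then show "a \<in> {u 0 | u. u \<in> complete_bounded_trajectories C S \<B>}"
        using \<open>u 0 = a\<close> by blast
    qed
    show "{u 0 | u. u \<in> complete_bounded_trajectories C S \<B>} \<subseteq> A"
      using trajectory_in_closed_attracting[OF assms(2) compact_imp_closed[OF \<open>compact A\<close>] attr]
      by blast
  qed
qed

end
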